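(* Let $G=(V,E)$, $w:E\to\mathbb{Q}_{\ge 0}$, be a concurrent (general graph matching) game. Then: (1) for every player $q\in V$: if $q$ is paid sometimes (i.e. $y_q>0$ for at least one imputation $y$ in the core), then $q$ is essential (i.e. $q$ is matched in every maximum weight integral matching of $G$); (2) for every team $e=(i,j)\in E$: if $e$ is viable or essential, then $e$ is always paid fairly (i.e. $y_i+y_j=w_e$ for every imputation $y$ in the core).
   Context: General graph matching game: $G=(V,E)$ is a finite undirected (not necessarily bipartite) graph with edge weights $w$. The players are the vertices and the teams are the edges. The worth $p(S)$ of a coalition $S\subseteq V$ is the weight of a maximum weight (integral) matching in the subgraph induced on $S$. An imputation is a function $y:V\to\mathbb{R}_{\ge 0}$ with $\sum_{i\in V}y_i=p(V)$. It is in the core if $\sum_{i\in S}y_i\ge p(S)$ for all $S\subseteq V$. A fractional matching is a vector $x\in\mathbb{R}_{\ge 0}^E$ with $\sum_{e\ni i}x_e\le 1$ for all $i\in V$; its weight is $\sum_e w_ex_e$. The game is concurrent if the maximum weight of a fractional matching equals the maximum weight of an integral matching (equivalently, the core is non-empty). A team $e$ is essential if it belongs to every maximum weight (integral) matching. It is viable if it belongs to some maximum weight matching and does not belong to some other one. *)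

theory Defs
  imports Complex_Main "HOL-Library.Disjoint_Sets"
begin

definition finite_graph :: "'a set \<Rightarrow> 'a set set \<Rightarrow> bool" where
  "finite_graph V E \<longleftrightarrow> finite V \<and> (\<forall>e\<in>E. e \<subseteq> V \<and> card e = 2)"

definition induced_edges :: "'a set set \<Rightarrow> 'a set \<Rightarrow> 'a set set" where
  "induced_edges E S = {e \<in> E. e \<subseteq> S}"

definition matching :: "'a set set \<Rightarrow> 'a set set \<Rightarrow> bool" where
  "matching E M \<longleftrightarrow> M \<subseteq> E \<and> disjoint M"

definition max_weight_matching :: "'a set set \<Rightarrow> ('a set \<Rightarrow> real) \<Rightarrow> 'a set set \<Rightarrow> bool" where
  "max_weight_matching E w M \<longleftrightarrow>
     matching E M \<and> (\<forall>M'. matching E M' \<longrightarrow> sum w M' \<le> sum w M)"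

text \<open>On a finite graph the maximum ranges over a finite set, which is nonempty
  because the empty matching is always available.\<close>

definition worth :: "'a set set \<Rightarrow> ('a set \<Rightarrow> real) \<Rightarrow> 'a set \<Rightarrow> real" where
  "worth E w S = Max (sum w ` {M. matching (induced_edges E S) M})"

text \<open>Profit vectors and fractional matchings are total functions; only their values
  on \<open>V\<close> and on \<open>E\<close>, respectively, are constrained or used.\<close>

definition imputation :: "'a set \<Rightarrow> 'a set set \<Rightarrow> ('a set \<Rightarrow> real) \<Rightarrow> ('a \<Rightarrow> real) \<Rightarrow> bool" where
  "imputation V E w y \<longleftrightarrow> (\<forall>i\<in>V. 0 \<le> y i) \<and> (\<Sum>i\<in>V. y i) = worth E w V"

definition core :: "'a set \<Rightarrow> 'a set set \<Rightarrow> ('a set \<Rightarrow> real) \<Rightarrow> ('a \<Rightarrow> real) set" where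
  "core V E w = {y. imputation V E w y \<and> (\<forall>S\<subseteq>V. worth E w S \<le> (\<Sum>i\<in>S. y i))}"

definition fractional_matching :: "'a set \<Rightarrow> 'a set set \<Rightarrow> ('a set \<Rightarrow> real) \<Rightarrow> bool" where
  "fractional_matching V E x \<longleftrightarrow>
     (\<forall>e\<in>E. 0 \<le> x e) \<and> (\<forall>i\<in>V. (\<Sum>e | e \<in> E \<and> i \<in> e. x e) \<le> 1)"

definition fractional_weight :: "'a set set \<Rightarrow> ('a set \<Rightarrow> real) \<Rightarrow> ('a set \<Rightarrow> real) \<Rightarrow> real" where
  "fractional_weight E w x = (\<Sum>e\<in>E. w e * x e)"

definition max_weight_fractional_matching ::
    "'a set \<Rightarrow> 'a set set \<Rightarrow> ('a set \<Rightarrow> real) \<Rightarrow> ('a set \<Rightarrow> real) \<Rightarrow> bool" where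
  "max_weight_fractional_matching V E w x \<longleftrightarrow>
     fractional_matching V E x \<and>
     (\<forall>x'. fractional_matching V E x' \<longrightarrow> fractional_weight E w x' \<le> fractional_weight E w x)"

text \<open>\<open>worth E w V\<close> is the maximum weight of an integral matching of the whole graph,
  since all edges lie inside \<open>V\<close>.\<close>

definition concurrent :: "'a set \<Rightarrow> 'a set set \<Rightarrow> ('a set \<Rightarrow> real) \<Rightarrow> bool" where
  "concurrent V E w \<longleftrightarrow>
     (\<exists>x. max_weight_fractional_matching V E w x \<and> fractional_weight E w x = worth E w V)"

definition essential_player :: "'a set set \<Rightarrow> ('a set \<Rightarrow> real) \<Rightarrow> 'a \<Rightarrow> bool" where
  "essential_player E w q \<longleftrightarrow> (\<forall>M. max_weight_matching E w M \<longrightarrow> (\<exists>e\<in>M. q \<in> e))"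

definition paid_sometimes :: "'a set \<Rightarrow> 'a set set \<Rightarrow> ('a set \<Rightarrow> real) \<Rightarrow> 'a \<Rightarrow> bool" where
  "paid_sometimes V E w q \<longleftrightarrow> (\<exists>y\<in>core V E w. 0 < y q)"

definition essential_team :: "'a set set \<Rightarrow> ('a set \<Rightarrow> real) \<Rightarrow> 'a set \<Rightarrow> bool" where
  "essential_team E w e \<longleftrightarrow> (\<forall>M. max_weight_matching E w M \<longrightarrow> e \<in> M)"

definition viable_team :: "'a set set \<Rightarrow> ('a set \<Rightarrow> real) \<Rightarrow> 'a set \<Rightarrow> bool" where
  "viable_team E w e \<longleftrightarrow>
     (\<exists>M. max_weight_matching E w M \<and> e \<in> M) \<and> (\<exists>M. max_weight_matching E w M \<and> e \<notin> M)"

definition always_paid_fairly ::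
    "'a set \<Rightarrow> 'a set set \<Rightarrow> ('a set \<Rightarrow> real) \<Rightarrow> 'a \<Rightarrow> 'a \<Rightarrow> bool" where
  "always_paid_fairly V E w i j \<longleftrightarrow> (\<forall>y\<in>core V E w. y i + y j = w {i, j})"

end

(* Complementary slackness.  For a core imputation y and a maximum weight matching M,
   w(M) \<le> y(\<Union>M) \<le> y(V) = p(V) = w(M), where the first inequality sums the core conditions
   of the edges of M.  Both inequalities are therefore equalities term by term: the edges of M
   are paid exactly their weight and vertices missed by M are paid 0. *)

theory Submission
  imports Defs
begin

lemma finite_graph_edges:
  assumes "finite_graph V E"
  shows "finite E" and "\<Union>E \<subseteq> V"
proof -
  show "\<Union>E \<subseteq> V"
    using assms unfolding finite_graph_def by blast
  then have "E \<subseteq> Pow V"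
    by blast
  then show "finite E"
    using assms finite_subset unfolding finite_graph_def by blast
qed

lemma finite_matchings: "finite E \<Longrightarrow> finite {M. matching E M}"
  by (rule finite_subset[of _ "Pow E"]) (auto simp: matching_def)

lemma induced_edges_whole: "\<Union>E \<subseteq> V \<Longrightarrow> induced_edges E V = E"
  unfolding induced_edges_def by blast

text \<open>Among finitely many matchings, the empty one included, some matching attains the
  maximum. Essentiality only quantifies over all maximum weight matchings, so this is what provides
  one containing an essential team.\<close>

lemma max_weight_matching_exists:
  assumes "finite E"
  shows "\<exists>M. max_weight_matching E w M"
proof -
  have "matching E {}"
    by (simp add: matching_def disjoint_def)
  then have "Max (sum w ` {M. matching E M}) \<in> sum w ` {M. matching E M}"
    using finite_matchings[OF assms] by (intro Max_in) auto
  then obtain M where "matching E M" and "Max (sum w ` {M. matching E M}) = sum w M"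
    by auto
  then show ?thesis
    using finite_matchings[OF assms] unfolding max_weight_matching_def
    by (metis Max_ge finite_imageI image_eqI mem_Collect_eq)
qed

text \<open>Lets the total payout of an imputation be compared with any chosen maximum weight
  matching.\<close>

lemma worth_max_weight_matching:
  assumes "finite_graph V E" and "max_weight_matching E w M"
  shows "worth E w V = sum w M"
  unfolding worth_def induced_edges_whole[OF finite_graph_edges(2)[OF assms(1)]]
  using assms(2) finite_matchings[OF finite_graph_edges(1)[OF assms(1)]]
  by (intro Max_eqI) (auto simp: max_weight_matching_def)

text \<open>The edge \<open>e\<close>, read as a coalition of its two endpoints, induces a subgraph
  in which \<open>{e}\<close> is already a matching.\<close>

lemma edge_weight_le_worth:
  assumes "finite E" and "e \<in> E"
  shows "w e \<le> worth E w e"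
proof -
  have "matching (induced_edges E e) {e}"
    using assms by (simp add: matching_def induced_edges_def disjoint_def)
  then have "w e \<in> sum w ` {M. matching (induced_edges E e) M}"
    by (intro image_eqI[of _ _ "{e}"]) simp_all
  moreover have "finite (induced_edges E e)"
    using assms(1) by (simp add: induced_edges_def)
  ultimately show ?thesis
    unfolding worth_def by (intro Max_ge finite_imageI finite_matchings)
qed

lemma core_complementary_slackness:
  assumes graph: "finite_graph V E" and y: "y \<in> core V E w"
    and M: "max_weight_matching E w M"
  shows "\<And>e. e \<in> M \<Longrightarrow> sum y e = w e" and "\<And>q. q \<in> V - \<Union>M \<Longrightarrow> y q = 0"
proof -
  have "finite V"
    using graph by (simp add: finite_graph_def)
  note E = finite_graph_edges[OF graph]
  have "M \<subseteq> E" and disj: "disjoint M"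
    using M by (auto simp: max_weight_matching_def matching_def)
  have "finite M"
    using \<open>M \<subseteq> E\<close> E(1) finite_subset by blast
  have "\<Union>M \<subseteq> V"
    using \<open>M \<subseteq> E\<close> E(2) by blast
  have nonneg: "0 \<le> y i" if "i \<in> V" for i
    using y that by (simp add: core_def imputation_def)
  have edge: "w e \<le> sum y e" if "e \<in> M" for e
  proof -
    have "e \<in> E" "e \<subseteq> V"
      using that \<open>M \<subseteq> E\<close> \<open>\<Union>M \<subseteq> V\<close> by auto
    \<comment> \<open>The core condition is taken at the coalition \<open>S = e\<close>.\<close>
    then show ?thesis
      using y edge_weight_le_worth[OF E(1), of e w] order_trans unfolding core_def by blast
  qed
  \<comment> \<open>No vertex is counted twice, because the edges of \<open>M\<close> are pairwise
    disjoint.\<close>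
  have "sum y (\<Union>M) = (\<Sum>e\<in>M. sum y e)"
    using \<open>finite V\<close> \<open>\<Union>M \<subseteq> V\<close> disj
    by (subst sum.Union_disjoint) (auto intro: finite_subset simp: disjoint_def)
  moreover have "sum y V = sum y (\<Union>M) + sum y (V - \<Union>M)"
    using \<open>finite V\<close> \<open>\<Union>M \<subseteq> V\<close> by (simp add: sum.subset_diff)
  moreover have "sum y V = sum w M"
    using y worth_max_weight_matching[OF graph M] by (simp add: core_def imputation_def)
  moreover have "0 \<le> sum y (V - \<Union>M)"
    using nonneg by (intro sum_nonneg) auto
  moreover have "sum w M \<le> (\<Sum>e\<in>M. sum y e)"
    using edge by (rule sum_mono)
  ultimately have "sum y (V - \<Union>M) = 0" and "(\<Sum>e\<in>M. sum y e) = sum w M"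
    by linarith+
  \<comment> \<open>The slacks \<open>sum y e - w e\<close> are nonnegative by \<open>edge\<close>;
    with total zero, each of them vanishes.\<close>
  then have "(\<Sum>e\<in>M. sum y e - w e) = 0"
    by (simp add: sum_subtractf)
  then show "sum y e = w e" if "e \<in> M" for e
    using sum_nonneg_eq_0_iff[OF \<open>finite M\<close>, of "\<lambda>e. sum y e - w e"] edge that by simp
  show "y q = 0" if "q \<in> V - \<Union>M" for q
    using sum_nonneg_eq_0_iff[of "V - \<Union>M" y] \<open>sum y (V - \<Union>M) = 0\<close> \<open>finite V\<close> nonneg that
    by simp
qed

theorem theorem7:
  fixes V :: "'a set" and E :: "'a set set" and w :: "'a set \<Rightarrow> real"
  assumes "finite_graph V E"
    and "\<forall>e\<in>E. w e \<in> \<rat> \<and> 0 \<le> w e"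
    and "concurrent V E w"
  shows "(\<forall>q\<in>V. paid_sometimes V E w q \<longrightarrow> essential_player E w q) \<and>
         (\<forall>i j. {i, j} \<in> E \<longrightarrow> viable_team E w {i, j} \<or> essential_team E w {i, j} \<longrightarrow>
            always_paid_fairly V E w i j)"
proof (intro conjI ballI allI impI)
  fix q
  assume "q \<in> V" and "paid_sometimes V E w q"
  then obtain y where "y \<in> core V E w" and "0 < y q"
    by (auto simp: paid_sometimes_def)
  \<comment> \<open>A maximum weight matching missing \<open>q\<close> would force
    \<open>y q = 0\<close>.\<close>
  then show "essential_player E w q"
    using core_complementary_slackness(2)[OF assms(1)] \<open>q \<in> V\<close>
    unfolding essential_player_def by fastforce
next
  fix i j
  assume "{i, j} \<in> E" and "viable_team E w {i, j} \<or> essential_team E w {i, j}"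
  \<comment> \<open>A viable team comes with such an \<open>M\<close>; for an essential team any
    maximum weight matching serves.\<close>
  then obtain M where M: "max_weight_matching E w M" "{i, j} \<in> M"
    using max_weight_matching_exists[OF finite_graph_edges(1)[OF assms(1)]]
    unfolding viable_team_def essential_team_def by blast
  \<comment> \<open>Distinct endpoints make \<open>sum y {i, j}\<close> equal to
    \<open>y i + y j\<close>; otherwise the set would collapse to one vertex.\<close>
  have "i \<noteq> j"
    using assms(1) \<open>{i, j} \<in> E\<close> by (auto simp: finite_graph_def)
  then show "always_paid_fairly V E w i j"
    using core_complementary_slackness(1)[OF assms(1) _ M] by (simp add: always_paid_fairly_def)
qed

end
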